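(* Let $X$ be an infinite-dimensional separable $F$-space, let $(Y_i)_{i\in\mathbb{N}}$ be topological vector spaces, and for each $i\in\mathbb{N}$ let $(T_{i,n}: X\to Y_i)_{n\in\mathbb{N}}$ be a sequence of linear operators. For each $i\in\mathbb{N}$ let $\Psi_i$ be a $D$-phenomenon from $X$ to $Y_i$ and let $\mathcal{F}_i$ be a proper Furstenberg family. Suppose that for every $m,i\in\mathbb{N}$ the set $\mathcal{F}_i\Psi_i((T_{i,n})_n : m)\subset X^m$ contains a residual subset of $X^m$. Then for each $m\in\mathbb{N}$ the set $$\bigcap_{i\in\mathbb{N}}\mathcal{F}_i\Psi_i((T_{i,n})_n : m)\subset X^m$$ is dense-lineable (in $X^m$).
   Context: An $F$-space is a completely metrizable topological vector space. A subset $A$ of a topological vector space $Z$ is dense-lineable if $A\cup\{0\}$ contains a dense vector subspace of $Z$. A set is residual if it contains a countable intersection of dense open sets. $D$-phenomenon: for topological vector spaces $X,Y$, a $D$-phenomenon $\Psi$ from $X$ to $Y$ assigns to each $x\in X$ a non-empty set $\Psi(x)$ of open subsets of $Y$ such that: for any $p=\sum_{j=1}^{m}\alpha_j x_j\in X$ with all scalars $\alpha_j\neq 0$ and any $V\in\Psi(p)$, there exist non-empty open sets $W_j\in\Psi(x_j)$, $j=1,\dots,m$, with $\sum_{j=1}^{m}\alpha_j W_j\subset V$. For $(x_1,\dots,x_m)\in X^m$ define $\Psi(x_1,\dots,x_m):=\{\prod_{j=1}^m A_j\subset Y^m : A_j\in\Psi(x_j)\}$. A Furstenberg family is a non-empty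 family $\mathcal{F}$ of subsets of $\mathbb{N}_0$ that is hereditary upward ($A\in\mathcal{F}$, $A\subset B$ imply $B\in\mathcal{F}$); it is proper if $\emptyset\notin\mathcal{F}$. For a sequence of operators $T_n:X\to Y$, a $D$-phenomenon $\Psi$ from $X$ to $Y$ and a proper Furstenberg family $\mathcal{F}$, the set $\mathcal{F}\Psi((T_n)_n:m)\subset X^m$ consists of all $q=(x_1,\dots,x_m)\in X^m$ such that for every $V\in\Psi(x_1,\dots,x_m)$ one has $\{n\in\mathbb{N}: (T_n(x_1),\dots,T_n(x_m))\in V\}\in\mathcal{F}$. *)

theory Defs
  imports "HOL-Analysis.Analysis" "Jordan_Normal_Form.Missing_VectorSpace"
begin

text \<open>
  Spaces are given by explicit carriers (records of type \<^typ>\<open>('k, 'v) module\<close>), so that the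
  members of a sequence \<open>Y 1, Y 2, \<dots>\<close> may be entirely different vector spaces. The record
  fields for the ring multiplication and unit of the module play no role. The scalar type ranges
  over class \<^class>\<open>real_normed_field\<close>, whose only members up to isomorphism are the
  real and the complex numbers (Gelfand--Mazur). Throughout, \<open>\<nat>\<close> is \<open>{1, 2, \<dots>}\<close>, and
  \<open>\<nat>\<^sub>0\<close> is the type \<^typ>\<open>nat\<close>.
\<close>

definition scalar_field :: "'k::field ring" where
  "scalar_field = \<lparr>carrier = UNIV, mult = (*), one = 1, zero = 0, add = (+)\<rparr>"

text \<open>No separation axiom is included.\<close>

definition topological_vector_space ::
    "('k::real_normed_field, 'v) module \<Rightarrow> 'v topology \<Rightarrow> bool" where
  "topological_vector_space V \<tau> \<longleftrightarrow>
     vectorspace scalar_field V \<and>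
     topspace \<tau> = carrier V \<and>
     continuous_map (prod_topology \<tau> \<tau>) \<tau> (\<lambda>(x, y). x \<oplus>\<^bsub>V\<^esub> y) \<and>
     continuous_map (prod_topology euclidean \<tau>) \<tau> (\<lambda>(a, x). a \<odot>\<^bsub>V\<^esub> x)"

definition F_space :: "('k::real_normed_field, 'v) module \<Rightarrow> 'v topology \<Rightarrow> bool" where
  "F_space V \<tau> \<longleftrightarrow> topological_vector_space V \<tau> \<and> completely_metrizable_space \<tau>"

definition infinite_dimensional :: "('k::field, 'v) module \<Rightarrow> bool" where
  "infinite_dimensional V \<longleftrightarrow> \<not> vectorspace.fin_dim scalar_field V"

text \<open>
  The power \<open>V\<^sup>m\<close>: an \<open>m\<close>-tuple is a function on \<open>{1..m}\<close>, extended by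
  \<^const>\<open>undefined\<close> outside, as in \<^const>\<open>product_topology\<close>.
\<close>

definition power_space :: "nat \<Rightarrow> ('k, 'v) module \<Rightarrow> ('k, nat \<Rightarrow> 'v) module" where
  "power_space m V =
     \<lparr>carrier = {1..m} \<rightarrow>\<^sub>E carrier V,
      mult = (\<lambda>p q. \<lambda>j\<in>{1..m}. p j \<otimes>\<^bsub>V\<^esub> q j),
      one = (\<lambda>j\<in>{1..m}. \<one>\<^bsub>V\<^esub>),
      zero = (\<lambda>j\<in>{1..m}. \<zero>\<^bsub>V\<^esub>),
      add = (\<lambda>p q. \<lambda>j\<in>{1..m}. p j \<oplus>\<^bsub>V\<^esub> q j),
      smult = (\<lambda>a p. \<lambda>j\<in>{1..m}. a \<odot>\<^bsub>V\<^esub> p j)\<rparr>"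

definition power_topology :: "nat \<Rightarrow> 'v topology \<Rightarrow> (nat \<Rightarrow> 'v) topology" where
  "power_topology m \<tau> = product_topology (\<lambda>_. \<tau>) {1..m}"

definition dense_lineable ::
    "('k::real_normed_field, 'v) module \<Rightarrow> 'v topology \<Rightarrow> 'v set \<Rightarrow> bool" where
  "dense_lineable Z \<tau> A \<longleftrightarrow>
     (\<exists>W. VectorSpace.subspace scalar_field W Z \<and> W \<subseteq> A \<union> {\<zero>\<^bsub>Z\<^esub>} \<and>
          \<tau> closure_of W = topspace \<tau>)"

definition residual_in :: "'v topology \<Rightarrow> 'v set \<Rightarrow> bool" where
  "residual_in \<tau> R \<longleftrightarrow> R \<subseteq> topspace \<tau> \<and>
     (\<exists>\<U>. countable \<U> \<and> (\<forall>U\<in>\<U>. openin \<tau> U \<and> \<tau> closure_of U = topspace \<tau>) \<and>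
          topspace \<tau> \<inter> \<Inter>\<U> \<subseteq> R)"

definition D_phenomenon ::
    "('k::real_normed_field, 'a) module \<Rightarrow> ('k, 'b) module \<Rightarrow> 'b topology
       \<Rightarrow> ('a \<Rightarrow> 'b set set) \<Rightarrow> bool" where
  "D_phenomenon X Y \<tau>Y \<Psi> \<longleftrightarrow>
     (\<forall>x\<in>carrier X. \<Psi> x \<noteq> {} \<and> (\<forall>V\<in>\<Psi> x. openin \<tau>Y V)) \<and>
     (\<forall>(m::nat) (\<alpha>::nat \<Rightarrow> 'k) (x::nat \<Rightarrow> 'a). 1 \<le> m \<longrightarrow>
        (\<forall>j\<in>{1..m}. \<alpha> j \<noteq> 0 \<and> x j \<in> carrier X) \<longrightarrow>
        (\<forall>V\<in>\<Psi> (\<Oplus>\<^bsub>X\<^esub>j\<in>{1..m}. \<alpha> j \<odot>\<^bsub>X\<^esub> x j).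
           \<exists>W. (\<forall>j\<in>{1..m}. W j \<in> \<Psi> (x j) \<and> W j \<noteq> {} \<and> openin \<tau>Y (W j)) \<and>
               {(\<Oplus>\<^bsub>Y\<^esub>j\<in>{1..m}. \<alpha> j \<odot>\<^bsub>Y\<^esub> w j) |w. \<forall>j\<in>{1..m}. w j \<in> W j} \<subseteq> V))"

definition tuple_phenomenon ::
    "nat \<Rightarrow> ('a \<Rightarrow> 'b set set) \<Rightarrow> (nat \<Rightarrow> 'a) \<Rightarrow> (nat \<Rightarrow> 'b) set set" where
  "tuple_phenomenon m \<Psi> x = {Pi\<^sub>E {1..m} A |A. \<forall>j\<in>{1..m}. A j \<in> \<Psi> (x j)}"

definition Furstenberg_family :: "nat set set \<Rightarrow> bool" where
  "Furstenberg_family \<F> \<longleftrightarrow> \<F> \<noteq> {} \<and> (\<forall>A B. A \<in> \<F> \<longrightarrow> A \<subseteq> B \<longrightarrow> B \<in> \<F>)"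

definition proper_Furstenberg_family :: "nat set set \<Rightarrow> bool" where
  "proper_Furstenberg_family \<F> \<longleftrightarrow> Furstenberg_family \<F> \<and> {} \<notin> \<F>"

definition F_Psi ::
    "('k, 'a) module \<Rightarrow> nat set set \<Rightarrow> ('a \<Rightarrow> 'b set set) \<Rightarrow> (nat \<Rightarrow> 'a \<Rightarrow> 'b) \<Rightarrow> nat
       \<Rightarrow> (nat \<Rightarrow> 'a) set" where
  "F_Psi X \<F> \<Psi> T m =
     {x \<in> carrier (power_space m X).
        \<forall>V\<in>tuple_phenomenon m \<Psi> x. {n. 1 \<le> n \<and> (\<lambda>j\<in>{1..m}. T n (x j)) \<in> V} \<in> \<F>}"

end

theory Submission
  imports Defs
begin

text \<open>
  In the space of arrays \<open>u\<close> with rows \<open>(u\<^bsub>l,1\<^esub>, \<dots>, u\<^bsub>l,m\<^esub>)\<close>, \<open>l \<in> \<nat>\<close>, which is again completely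
  metrizable, a generic \<open>u\<close> has all its finite families of entries in the given residual sets,
  and its rows are dense in \<open>X\<^sup>m\<close>. The span of the rows is the required dense subspace: if \<open>p\<close> is
  a combination of finitely many rows with nonzero coefficients, then the defining property of a
  \<open>D\<close>-phenomenon turns neighbourhoods in \<open>\<Psi>(p\<^sub>1), \<dots>, \<Psi>(p\<^sub>m)\<close> into neighbourhoods of the entries of
  these rows. Since different \<open>p\<^sub>j\<close> involve different entries, the latter can be visited
  simultaneously, and by linearity \<open>p\<close> makes its visits at the same times.
\<close>

section \<open>Residual sets in product spaces\<close>

lemma separable_metrizable_imp_second_countable:
  assumes "metrizable_space X" and "separable_space X"
  shows "second_countable X"
proof -
  obtain M d where metric: "Metric_space M d" and X_eq: "X = Metric_space.mtopology M d"
    using assms(1) unfolding metrizable_space_def by blast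
  interpret Metric_space M d by (fact metric)
  obtain C where "countable C" and dense: "mtopology closure_of C = M"
    using assms(2) unfolding separable_space_def X_eq by auto
  define \<B> where "\<B> = (\<lambda>(c, n). mball c (inverse (real (Suc n)))) ` (C \<times> UNIV)"
  have "\<exists>V\<in>\<B>. x \<in> V \<and> V \<subseteq> U" if "openin mtopology U" "x \<in> U" for U x
  proof -
    from that obtain r where "r > 0" and ball_subset: "mball x r \<subseteq> U" and "x \<in> M"
      unfolding openin_mtopology by blast
    obtain n where small: "inverse (real (Suc n)) < r / 2"
      using reals_Archimedean[of "r / 2"] \<open>r > 0\<close> by auto
    have "x \<in> mball x (inverse (real (Suc n)))"
      using \<open>x \<in> M\<close> by simp
    then obtain c where "c \<in> C" and near: "c \<in> mball x (inverse (real (Suc n)))"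
      using dense openin_mball dense_intersects_open[of mtopology C]
      unfolding topspace_mtopology by blast
    have "mball c (inverse (real (Suc n))) \<subseteq> mball x r"
      using near small by (intro mball_subset) (auto simp: commute)
    moreover have "x \<in> mball c (inverse (real (Suc n)))"
      using near by (auto simp: commute)
    ultimately show ?thesis
      using ball_subset \<open>c \<in> C\<close> unfolding \<B>_def by blast
  qed
  moreover have "countable \<B>" and "\<forall>V\<in>\<B>. openin mtopology V"
    using \<open>countable C\<close> unfolding \<B>_def by auto
  ultimately show ?thesis
    unfolding second_countable_def X_eq by blast
qed

lemma second_countable_product_topology:
  assumes "finite J" and "\<And>j. j \<in> J \<Longrightarrow> second_countable (X j)"
  shows "second_countable (product_topology X J)"
proof -
  obtain \<B> where \<B>: "\<And>j. j \<in> J \<Longrightarrow> countable (\<B> j)"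
      "\<And>j V. j \<in> J \<Longrightarrow> V \<in> \<B> j \<Longrightarrow> openin (X j) V"
      "\<And>j U x. j \<in> J \<Longrightarrow> openin (X j) U \<Longrightarrow> x \<in> U \<Longrightarrow> \<exists>V\<in>\<B> j. x \<in> V \<and> V \<subseteq> U"
    using assms(2) unfolding second_countable_def by metis
  have "\<exists>V\<in>Pi\<^sub>E J ` Pi\<^sub>E J \<B>. x \<in> V \<and> V \<subseteq> U" if U: "openin (product_topology X J) U" "x \<in> U" for U x
  proof -
    obtain A where A: "x \<in> Pi\<^sub>E J A" "\<And>j. openin (X j) (A j)" "Pi\<^sub>E J A \<subseteq> U"
      using product_topology_open_contains_basis[OF U] by metis
    have "\<forall>j\<in>J. \<exists>V\<in>\<B> j. x j \<in> V \<and> V \<subseteq> A j"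
      using \<B>(3)[OF _ A(2)] A(1) by blast
    then obtain B where B: "\<And>j. j \<in> J \<Longrightarrow> B j \<in> \<B> j \<and> x j \<in> B j \<and> B j \<subseteq> A j"
      by metis
    have "x \<in> Pi\<^sub>E J (restrict B J)"
      using A(1) B by (simp add: PiE_iff)
    moreover have "Pi\<^sub>E J (restrict B J) \<subseteq> Pi\<^sub>E J A"
      using B by (intro PiE_mono) simp
    ultimately show ?thesis
      using A(3) B by (intro bexI[of _ "Pi\<^sub>E J (restrict B J)"]) auto
  qed
  moreover have "countable (Pi\<^sub>E J ` Pi\<^sub>E J \<B>)"
    using \<B>(1) \<open>finite J\<close> by (intro countable_image countable_PiE)
  moreover have "\<forall>V\<in>Pi\<^sub>E J ` Pi\<^sub>E J \<B>. openin (product_topology X J) V"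
    using \<B>(2) \<open>finite J\<close> by (auto simp: openin_PiE_gen PiE_iff)
  ultimately show ?thesis
    unfolding second_countable_def by (intro exI[of _ "Pi\<^sub>E J ` Pi\<^sub>E J \<B>"]) blast
qed

lemma residual_in_mono:
  "residual_in X R \<Longrightarrow> R \<subseteq> S \<Longrightarrow> S \<subseteq> topspace X \<Longrightarrow> residual_in X S"
  unfolding residual_in_def by (meson subset_trans)

lemma residual_in_open_dense:
  "openin X U \<Longrightarrow> X closure_of U = topspace X \<Longrightarrow> residual_in X U"
  unfolding residual_in_def by (intro conjI exI[of _ "{U}"]) (auto dest: openin_subset)

lemma residual_in_Ball:
  assumes "countable I" and residual: "\<And>i. i \<in> I \<Longrightarrow> residual_in X {x \<in> topspace X. Q i x}"
  shows "residual_in X {x \<in> topspace X. \<forall>i\<in>I. Q i x}"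
proof -
  have "\<forall>i\<in>I. \<exists>\<U>. countable \<U> \<and> (\<forall>U\<in>\<U>. openin X U \<and> X closure_of U = topspace X) \<and>
      topspace X \<inter> \<Inter>\<U> \<subseteq> {x \<in> topspace X. Q i x}"
    using residual unfolding residual_in_def by blast
  from bchoice[OF this] obtain \<U> where \<U>: "\<forall>i\<in>I. countable (\<U> i) \<and>
      (\<forall>U\<in>\<U> i. openin X U \<and> X closure_of U = topspace X) \<and>
      topspace X \<inter> \<Inter>(\<U> i) \<subseteq> {x \<in> topspace X. Q i x}"
    by (elim exE)
  then have "countable (\<Union>(\<U> ` I))"
    using \<open>countable I\<close> by simp
  moreover have "\<forall>U\<in>\<Union>(\<U> ` I). openin X U \<and> X closure_of U = topspace X"
    using \<U> by blast
  moreover have "topspace X \<inter> \<Inter>(\<Union>(\<U> ` I)) \<subseteq> {x \<in> topspace X. \<forall>i\<in>I. Q i x}"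
  proof (intro subsetI CollectI conjI ballI)
    fix x i assume "x \<in> topspace X \<inter> \<Inter>(\<Union>(\<U> ` I))" "i \<in> I"
    then have "x \<in> topspace X \<inter> \<Inter>(\<U> i)"
      by blast
    with bspec[OF \<U> \<open>i \<in> I\<close>] show "Q i x"
      by blast
  qed simp
  ultimately show ?thesis
    unfolding residual_in_def by (intro conjI exI[of _ "\<Union>(\<U> ` I)"] Collect_restrict)
qed

lemma residual_in_conj:
  assumes "residual_in X {x \<in> topspace X. P x}" and "residual_in X {x \<in> topspace X. Q x}"
  shows "residual_in X {x \<in> topspace X. P x \<and> Q x}"
proof -
  have "residual_in X {x \<in> topspace X. \<forall>b\<in>UNIV. if b then P x else Q x}"
  proof (rule residual_in_Ball)
    show "residual_in X {x \<in> topspace X. if b then P x else Q x}" for b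
      using assms by (cases b) simp_all
  qed simp
  then show ?thesis
    by (simp add: all_bool_eq)
qed

lemma residual_in_nonempty:
  assumes "completely_metrizable_space X" and "topspace X \<noteq> {}" and "residual_in X R"
  shows "R \<noteq> {}"
proof -
  obtain \<U> where \<U>: "countable \<U>" "\<And>U. U \<in> \<U> \<Longrightarrow> openin X U \<and> X closure_of U = topspace X"
      "topspace X \<inter> \<Inter>\<U> \<subseteq> R"
    using assms(3) unfolding residual_in_def by blast
  have "X closure_of \<Inter>\<U> = topspace X"
    using assms(1) \<U>(1,2) by (intro Baire_category) auto
  then have "\<Inter>\<U> \<inter> topspace X \<noteq> {}"
    using assms(2) openin_topspace unfolding dense_intersects_open by blast
  with \<U>(3) show ?thesis
    by blast
qed

lemma dense_open_map_preimage:
  assumes "open_map X Y f" and "Y closure_of D = topspace Y"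
  shows "X closure_of {x \<in> topspace X. f x \<in> D} = topspace X"
  unfolding dense_intersects_open
proof (intro allI impI, elim conjE)
  fix S assume S: "openin X S" "S \<noteq> {}"
  then have "openin Y (f ` S)" "f ` S \<noteq> {}"
    using assms(1) unfolding open_map_def by auto
  then have "D \<inter> f ` S \<noteq> {}"
    using assms(2) unfolding dense_intersects_open by blast
  with openin_subset[OF S(1)] show "{x \<in> topspace X. f x \<in> D} \<inter> S \<noteq> {}"
    by blast
qed

lemma residual_in_open_map_preimage:
  assumes cont: "continuous_map X Y f" and "open_map X Y f" and "residual_in Y R"
  shows "residual_in X {x \<in> topspace X. f x \<in> R}"
proof -
  obtain \<U> where \<U>: "countable \<U>" "\<And>U. U \<in> \<U> \<Longrightarrow> openin Y U \<and> Y closure_of U = topspace Y"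
      "topspace Y \<inter> \<Inter>\<U> \<subseteq> R"
    using assms(3) unfolding residual_in_def by blast
  let ?preimage = "\<lambda>U. {x \<in> topspace X. f x \<in> U}"
  have "openin X (?preimage U) \<and> X closure_of (?preimage U) = topspace X" if "U \<in> \<U>" for U
    using \<U>(2)[OF that] openin_continuous_map_preimage[OF cont]
      dense_open_map_preimage[OF assms(2)] by blast
  moreover have "topspace X \<inter> \<Inter>(?preimage ` \<U>) \<subseteq> ?preimage R"
    using \<U>(3) continuous_map_funspace[OF cont] by fast
  ultimately show ?thesis
    unfolding residual_in_def using \<U>(1) by (intro conjI exI[of _ "?preimage ` \<U>"]) auto
qed

lemma continuous_map_product_reindex:
  assumes "h ` I \<subseteq> K"
  shows "continuous_map (product_topology X K) (product_topology (\<lambda>i. X (h i)) I)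
           (\<lambda>u. \<lambda>i\<in>I. u (h i))"
  using assms by (auto simp: continuous_map_componentwise)

lemma image_reindex_PiE:
  assumes "inj_on h I" and "h ` I \<subseteq> K" and "Pi\<^sub>E K B \<noteq> {}"
  shows "(\<lambda>u. \<lambda>i\<in>I. u (h i)) ` Pi\<^sub>E K B = (\<Pi>\<^sub>E i\<in>I. B (h i))"
proof (intro equalityI subsetI)
  fix y assume y: "y \<in> (\<Pi>\<^sub>E i\<in>I. B (h i))"
  obtain x where x: "x \<in> Pi\<^sub>E K B"
    using assms(3) by blast
  define u where "u = (\<lambda>k. if k \<in> h ` I then y (inv_into I h k) else x k)"
  have "u \<in> Pi\<^sub>E K B"
    using x y assms(1,2) by (auto simp: u_def PiE_iff extensional_def)
  moreover have "y = (\<lambda>i\<in>I. u (h i))"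
    using y assms(1) by (auto simp: u_def PiE_iff extensional_def)
  ultimately show "y \<in> (\<lambda>u. \<lambda>i\<in>I. u (h i)) ` Pi\<^sub>E K B"
    by blast
qed (use assms(2) in \<open>auto simp: image_subset_iff PiE_iff\<close>)

lemma open_map_product_reindex:
  assumes "inj_on h I" and "h ` I \<subseteq> K"
  shows "open_map (product_topology X K) (product_topology (\<lambda>i. X (h i)) I) (\<lambda>u. \<lambda>i\<in>I. u (h i))"
    (is "open_map _ ?Y ?f")
  unfolding open_map_def
proof (intro allI impI)
  fix S assume S: "openin (product_topology X K) S"
  show "openin ?Y (?f ` S)"
  proof (subst openin_subopen, rule ballI)
    fix y assume "y \<in> ?f ` S"
    then obtain x where x: "x \<in> S" "y = ?f x"
      by blast
    obtain B where B: "x \<in> Pi\<^sub>E K B" "\<forall>k. openin (X k) (B k)"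
        "finite {k. B k \<noteq> topspace (X k)}" "Pi\<^sub>E K B \<subseteq> S"
      using product_topology_open_contains_basis[OF S x(1)] by (elim exE conjE)
    have image: "?f ` Pi\<^sub>E K B = (\<Pi>\<^sub>E i\<in>I. B (h i))"
      using B(1) by (intro image_reindex_PiE[OF assms]) blast
    have "finite {i \<in> I. B (h i) \<noteq> topspace (X (h i))}"
      by (rule finite_subset[OF _ finite_vimage_IntI[OF B(3) assms(1)]]) auto
    then have "openin ?Y (?f ` Pi\<^sub>E K B)"
      unfolding image openin_PiE_gen using B(2) by blast
    moreover have "y \<in> ?f ` Pi\<^sub>E K B" and "?f ` Pi\<^sub>E K B \<subseteq> ?f ` S"
      using x(2) B(1,4) by (simp_all add: image_mono)
    ultimately show "\<exists>T. openin ?Y T \<and> y \<in> T \<and> T \<subseteq> ?f ` S"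
      by blast
  qed
qed

lemma residual_in_product_reindex:
  assumes "inj_on h I" and "h ` I \<subseteq> K" and "residual_in (product_topology (\<lambda>i. X (h i)) I) R"
  shows "residual_in (product_topology X K)
           {u \<in> topspace (product_topology X K). (\<lambda>i\<in>I. u (h i)) \<in> R}"
  using continuous_map_product_reindex open_map_product_reindex assms
  by (intro residual_in_open_map_preimage)

section \<open>Arrays with dense rows\<close>

definition array_row :: "'j set \<Rightarrow> ('i \<times> 'j \<Rightarrow> 'a) \<Rightarrow> 'i \<Rightarrow> 'j \<Rightarrow> 'a" where
  "array_row J u i = (\<lambda>j\<in>J. u (i, j))"

lemma openin_row_visits:
  fixes I :: "'i set"
  assumes "openin (product_topology (\<lambda>_. X) J) B"
  defines "P \<equiv> product_topology (\<lambda>_. X) (I \<times> J)"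
  shows "openin P {u \<in> topspace P. \<exists>i\<in>I. array_row J u i \<in> B}"
proof -
  have "openin P {u \<in> topspace P. array_row J u i \<in> B}" if "i \<in> I" for i
    unfolding P_def array_row_def using that assms(1)
    by (intro openin_continuous_map_preimage[OF continuous_map_product_reindex]) auto
  then have "openin P (\<Union>i\<in>I. {u \<in> topspace P. array_row J u i \<in> B})"
    by blast
  also have "(\<Union>i\<in>I. {u \<in> topspace P. array_row J u i \<in> B})
      = {u \<in> topspace P. \<exists>i\<in>I. array_row J u i \<in> B}"
    by blast
  finally show ?thesis .
qed

lemma dense_row_visits:
  assumes "infinite I" and B: "openin (product_topology (\<lambda>_. X) J) B" "B \<noteq> {}"
  defines "P \<equiv> product_topology (\<lambda>_. X) (I \<times> J)"
  shows "P closure_of {u \<in> topspace P. \<exists>i\<in>I. array_row J u i \<in> B} = topspace P"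
  unfolding dense_intersects_open
proof (intro allI impI, elim conjE)
  fix S assume S: "openin P S" "S \<noteq> {}"
  then obtain x where "x \<in> S"
    by blast
  then obtain A where A: "x \<in> Pi\<^sub>E (I \<times> J) A" "\<And>k. openin X (A k)"
      "finite {k. A k \<noteq> topspace X}" "Pi\<^sub>E (I \<times> J) A \<subseteq> S"
    using product_topology_open_contains_basis[OF S(1)[unfolded P_def]] by metis
  have "infinite (I - fst ` {k. A k \<noteq> topspace X})"
    using A(3) \<open>infinite I\<close> by simp
  then obtain i where "i \<in> I" "i \<notin> fst ` {k. A k \<noteq> topspace X}"
    using infinite_imp_nonempty by blast
  then have i: "i \<in> I" "\<And>j. A (i, j) = topspace X"
    by force+
  obtain z where z: "z \<in> B"
    using B(2) by blast
  then have zX: "z \<in> J \<rightarrow>\<^sub>E topspace X"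
    using openin_subset[OF B(1)] by auto
  define u where "u = (\<lambda>k. if k \<in> {i} \<times> J then z (snd k) else x k)"
  have "u \<in> Pi\<^sub>E (I \<times> J) A"
    using A(1) i zX by (auto simp: u_def PiE_iff extensional_def)
  then have "u \<in> S"
    using A(4) by blast
  moreover have "array_row J u i = z"
    using zX by (auto simp: u_def array_row_def PiE_iff extensional_def)
  ultimately show "{u \<in> topspace P. \<exists>i\<in>I. array_row J u i \<in> B} \<inter> S \<noteq> {}"
    using z i(1) openin_subset[OF S(1)] by blast
qed

lemma residual_in_dense_rows:
  fixes I :: "'i set" and J :: "'j set"
  assumes "second_countable X" and "infinite I" and "finite J"
  defines "P \<equiv> product_topology (\<lambda>_. X) (I \<times> J)" and "Q \<equiv> product_topology (\<lambda>_. X) J"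
  shows "residual_in P {u \<in> topspace P. Q closure_of (array_row J u ` I) = topspace Q}"
proof -
  have "second_countable Q"
    unfolding Q_def using assms(1,3) by (intro second_countable_product_topology)
  then obtain \<B> where \<B>: "countable \<B>" "\<And>B. B \<in> \<B> \<Longrightarrow> openin Q B"
      "\<And>S x. openin Q S \<Longrightarrow> x \<in> S \<Longrightarrow> \<exists>B\<in>\<B>. x \<in> B \<and> B \<subseteq> S"
    unfolding second_countable_def by metis
  let ?visits = "\<lambda>B. {u \<in> topspace P. \<exists>i\<in>I. array_row J u i \<in> B}"
  have "residual_in P (?visits B)" if "B \<in> \<B> - {{}}" for B
    unfolding P_def using that \<B>(2)[unfolded Q_def] \<open>infinite I\<close>
    by (intro residual_in_open_dense openin_row_visits dense_row_visits) auto
  then have "residual_in P {u \<in> topspace P. \<forall>B\<in>\<B> - {{}}. \<exists>i\<in>I. array_row J u i \<in> B}"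
    using \<B>(1) by (intro residual_in_Ball) auto
  moreover have "Q closure_of (array_row J u ` I) = topspace Q"
    if "\<forall>B\<in>\<B> - {{}}. \<exists>i\<in>I. array_row J u i \<in> B" for u
    unfolding dense_intersects_open
  proof (intro allI impI, elim conjE)
    fix S assume "openin Q S" "S \<noteq> {}"
    then obtain B where "B \<in> \<B> - {{}}" "B \<subseteq> S"
      using \<B>(3) by blast
    with that show "array_row J u ` I \<inter> S \<noteq> {}"
      by blast
  qed
  ultimately show ?thesis
    by (elim residual_in_mono) auto
qed

section \<open>Joint recurrence of families of vectors\<close>

definition jointly_recurrent ::
    "nat set set \<Rightarrow> ('a \<Rightarrow> 'b set set) \<Rightarrow> (nat \<Rightarrow> 'a \<Rightarrow> 'b) \<Rightarrow> 'j set \<Rightarrow> ('j \<Rightarrow> 'a) \<Rightarrow> bool" where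
  "jointly_recurrent \<F> \<Psi> T J x \<longleftrightarrow>
     (\<forall>A\<in>\<Pi> j\<in>J. \<Psi> (x j). {n. 1 \<le> n \<and> (\<forall>j\<in>J. T n (x j) \<in> A j)} \<in> \<F>)"

lemma F_Psi_iff_jointly_recurrent:
  "x \<in> F_Psi X \<F> \<Psi> T m \<longleftrightarrow>
     x \<in> {1..m} \<rightarrow>\<^sub>E carrier X \<and> jointly_recurrent \<F> \<Psi> T {1..m} x"
proof -
  have "(\<forall>V\<in>tuple_phenomenon m \<Psi> x. Q V) \<longleftrightarrow> (\<forall>A\<in>\<Pi> j\<in>{1..m}. \<Psi> (x j). Q (Pi\<^sub>E {1..m} A))" for Q
    unfolding tuple_phenomenon_def by (auto simp: Pi_iff)
  then show ?thesis
    unfolding F_Psi_def jointly_recurrent_def power_space_def by (simp add: Pi_iff)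
qed

lemma jointly_recurrentD:
  "jointly_recurrent \<F> \<Psi> T J x \<Longrightarrow> A \<in> (\<Pi> j\<in>J. \<Psi> (x j)) \<Longrightarrow>
     {n. 1 \<le> n \<and> (\<forall>j\<in>J. T n (x j) \<in> A j)} \<in> \<F>"
  unfolding jointly_recurrent_def by blast

lemma jointly_recurrent_bij_betw:
  assumes bij: "bij_betw h I J" and x_eq: "\<And>i. i \<in> I \<Longrightarrow> x i = y (h i)"
    and recurrent: "jointly_recurrent \<F> \<Psi> T I x"
  shows "jointly_recurrent \<F> \<Psi> T J y"
  unfolding jointly_recurrent_def
proof
  fix A assume "A \<in> (\<Pi> j\<in>J. \<Psi> (y j))"
  then have "(\<lambda>i. A (h i)) \<in> (\<Pi> i\<in>I. \<Psi> (x i))"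
    using bij_betwE[OF bij] x_eq by auto
  from jointly_recurrentD[OF recurrent this]
  show "{n. 1 \<le> n \<and> (\<forall>j\<in>J. T n (y j) \<in> A j)} \<in> \<F>"
    using x_eq by (simp flip: bij_betw_imp_surj_on[OF bij])
qed

lemma jointly_recurrent_reindex:
  assumes bij: "bij_betw h I J" and x_eq: "\<And>i. i \<in> I \<Longrightarrow> x i = y (h i)"
  shows "jointly_recurrent \<F> \<Psi> T I x \<longleftrightarrow> jointly_recurrent \<F> \<Psi> T J y"
proof
  show "jointly_recurrent \<F> \<Psi> T J y" if "jointly_recurrent \<F> \<Psi> T I x"
    by (rule jointly_recurrent_bij_betw[OF bij x_eq that])
  have "y j = x (inv_into I h j)" if "j \<in> J" for j
    using x_eq[of "inv_into I h j"] that bij_betwE[OF bij_betw_inv_into[OF bij]]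
      bij_betw_inv_into_right[OF bij] by simp
  then show "jointly_recurrent \<F> \<Psi> T I x" if "jointly_recurrent \<F> \<Psi> T J y"
    using jointly_recurrent_bij_betw[OF bij_betw_inv_into[OF bij] _ that] by blast
qed

lemma residual_in_jointly_recurrent:
  assumes "finite F" "F \<noteq> {}" "F \<subseteq> K"
    and residual: "\<And>N. 1 \<le> N \<Longrightarrow> residual_in (power_topology N \<tau>) (F_Psi X \<F> \<Psi> T N)"
  defines "P \<equiv> product_topology (\<lambda>_. \<tau>) K"
  shows "residual_in P {u \<in> topspace P. jointly_recurrent \<F> \<Psi> T F u}"
proof -
  obtain h N where bij: "bij_betw h {1..N} F" and "N = card F"
    using ex_bij_betw_nat_finite_1[OF \<open>finite F\<close>] by blast
  let ?R = "{u \<in> topspace P. (\<lambda>i\<in>{1..N}. u (h i)) \<in> F_Psi X \<F> \<Psi> T N}"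
  have "1 \<le> N"
    using assms(1,2) \<open>N = card F\<close> by (simp add: Suc_le_eq card_gt_0_iff)
  have "residual_in P ?R"
    unfolding P_def
  proof (rule residual_in_product_reindex)
    show "inj_on h {1..N}"
      by (rule bij_betw_imp_inj_on[OF bij])
    show "h ` {1..N} \<subseteq> K"
      using \<open>F \<subseteq> K\<close> unfolding bij_betw_imp_surj_on[OF bij] .
    show "residual_in (product_topology (\<lambda>_. \<tau>) {1..N}) (F_Psi X \<F> \<Psi> T N)"
      using residual[OF \<open>1 \<le> N\<close>] unfolding power_topology_def .
  qed
  moreover have "jointly_recurrent \<F> \<Psi> T F u" if "u \<in> ?R" for u
  proof (rule jointly_recurrent_bij_betw[OF bij])
    show "jointly_recurrent \<F> \<Psi> T {1..N} (\<lambda>i\<in>{1..N}. u (h i))"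
      using that unfolding F_Psi_iff_jointly_recurrent by blast
  qed simp
  ultimately show ?thesis
    by (elim residual_in_mono) blast+
qed

lemma generic_array:
  assumes "completely_metrizable_space \<tau>" and "separable_space \<tau>" and "topspace \<tau> \<noteq> {}"
    and "countable I" "infinite I" and "finite J" and "countable C"
    and residual: "\<And>c N. c \<in> C \<Longrightarrow> 1 \<le> N \<Longrightarrow>
          residual_in (power_topology N \<tau>) (F_Psi X (\<F> c) (\<Psi> c) (T c) N)"
  obtains u where "u \<in> I \<times> J \<rightarrow>\<^sub>E topspace \<tau>"
    and "product_topology (\<lambda>_. \<tau>) J closure_of (array_row J u ` I)
           = topspace (product_topology (\<lambda>_. \<tau>) J)"
    and "\<And>c F. c \<in> C \<Longrightarrow> finite F \<Longrightarrow> F \<noteq> {} \<Longrightarrow> F \<subseteq> I \<times> J \<Longrightarrow>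
           jointly_recurrent (\<F> c) (\<Psi> c) (T c) F u"
proof -
  define P where "P = product_topology (\<lambda>_. \<tau>) (I \<times> J)"
  define Q where "Q = product_topology (\<lambda>_. \<tau>) J"
  define \<S> where "\<S> = {F. finite F \<and> F \<subseteq> I \<times> J} - {{}}"
  have countable: "countable (I \<times> J)"
    using assms(4,6) by (simp add: countable_finite)
  have "completely_metrizable_space P"
    using assms(1) countable_subset[OF _ countable]
    by (simp add: P_def completely_metrizable_space_product_topology)
  moreover have "topspace P \<noteq> {}"
    using assms(3) by (simp add: P_def PiE_eq_empty_iff)
  moreover have "residual_in P {u \<in> topspace P. Q closure_of (array_row J u ` I) = topspace Q \<and>
      (\<forall>c\<in>C. \<forall>F\<in>\<S>. jointly_recurrent (\<F> c) (\<Psi> c) (T c) F u)}"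
  proof (intro residual_in_conj residual_in_Ball)
    show "residual_in P {u \<in> topspace P. Q closure_of (array_row J u ` I) = topspace Q}"
      unfolding P_def Q_def using assms(1,2,5,6)
      by (intro residual_in_dense_rows separable_metrizable_imp_second_countable
          completely_metrizable_imp_metrizable_space)
    show "countable C" and "countable \<S>"
      using assms(7) countable by (simp_all add: \<S>_def countable_Collect_finite_subset)
    show "residual_in P {u \<in> topspace P. jointly_recurrent (\<F> c) (\<Psi> c) (T c) F u}"
      if "c \<in> C" "F \<in> \<S>" for c F
      unfolding P_def using that residual[of c]
      by (intro residual_in_jointly_recurrent) (auto simp: \<S>_def)
  qed
  ultimately obtain u where "u \<in> topspace P" "Q closure_of (array_row J u ` I) = topspace Q"
      "\<And>c F. c \<in> C \<Longrightarrow> F \<in> \<S> \<Longrightarrow> jointly_recurrent (\<F> c) (\<Psi> c) (T c) F u"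
    using residual_in_nonempty by blast
  then show ?thesis
    by (intro that[of u]) (simp_all add: P_def Q_def \<S>_def)
qed

section \<open>Linear combinations of rows\<close>

lemma scalar_field_simps [simp]:
  "carrier (scalar_field :: 'k::field ring) = UNIV" "\<zero>\<^bsub>scalar_field\<^esub> = (0 :: 'k)"
  by (simp_all add: scalar_field_def)

lemma vectorspace_power_space:
  assumes "vectorspace scalar_field V"
  shows "vectorspace scalar_field (power_space m V)"
proof -
  interpret V: vectorspace scalar_field V by (fact assms)
  have "module scalar_field (power_space m V)"
  proof (rule moduleI)
    show "abelian_group (power_space m V)"
    proof (rule abelian_groupI)
      fix x assume "x \<in> carrier (power_space m V)"
      then show "\<exists>y\<in>carrier (power_space m V). y \<oplus>\<^bsub>power_space m V\<^esub> x = \<zero>\<^bsub>power_space m V\<^esub>"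
        by (intro bexI[of _ "\<lambda>j\<in>{1..m}. \<ominus>\<^bsub>V\<^esub> x j"])
          (auto simp: power_space_def PiE_iff V.l_neg fun_eq_iff)
    qed (auto simp: power_space_def PiE_iff fun_eq_iff extensional_def V.a_ac)
  qed (auto simp: power_space_def PiE_iff fun_eq_iff V.is_cring V.smult_l_distr V.smult_r_distr
        V.smult_assoc1 extensional_def)
  then show ?thesis by (intro vectorspace.intro V.field_axioms)
qed

lemma finsum_power_space:
  assumes "vectorspace scalar_field V" and "finite A" and "g \<in> A \<rightarrow> {1..m} \<rightarrow>\<^sub>E carrier V"
  shows "(\<Oplus>\<^bsub>power_space m V\<^esub>a\<in>A. g a) = (\<lambda>j\<in>{1..m}. \<Oplus>\<^bsub>V\<^esub>a\<in>A. g a j)"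
proof -
  interpret V: vectorspace scalar_field V by (fact assms)
  interpret P: vectorspace scalar_field "power_space m V"
    by (rule vectorspace_power_space[OF assms(1)])
  show ?thesis
    using assms(2,3)
  proof (induction A rule: finite_induct)
    case empty
    show ?case
      unfolding P.finsum_empty V.finsum_empty by (simp add: power_space_def)
  next
    case (insert a A)
    then have "g a \<in> carrier (power_space m V)" "g \<in> A \<rightarrow> carrier (power_space m V)"
      by (auto simp: power_space_def)
    with insert.hyps have "(\<Oplus>\<^bsub>power_space m V\<^esub>b\<in>insert a A. g b)
        = g a \<oplus>\<^bsub>power_space m V\<^esub> (\<Oplus>\<^bsub>power_space m V\<^esub>b\<in>A. g b)"
      by (intro P.finsum_insert)
    also have "(\<Oplus>\<^bsub>power_space m V\<^esub>b\<in>A. g b) = (\<lambda>j\<in>{1..m}. \<Oplus>\<^bsub>V\<^esub>b\<in>A. g b j)"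
      using insert.prems by (intro insert.IH) auto
    also have "g a \<oplus>\<^bsub>power_space m V\<^esub> \<dots>
        = (\<lambda>j\<in>{1..m}. g a j \<oplus>\<^bsub>V\<^esub> (\<Oplus>\<^bsub>V\<^esub>b\<in>A. g b j))"
      by (auto simp: power_space_def)
    also have "\<dots> = (\<lambda>j\<in>{1..m}. \<Oplus>\<^bsub>V\<^esub>b\<in>insert a A. g b j)"
      using insert by (intro restrict_ext V.finsum_insert[symmetric]) (auto simp: Pi_iff PiE_iff)
    finally show ?case .
  qed
qed

lemma (in mod_hom) hom_finsum_smult:
  assumes "finite A" and "c \<in> A \<rightarrow> carrier R" and "x \<in> A \<rightarrow> carrier M"
  shows "f (\<Oplus>\<^bsub>M\<^esub>i\<in>A. c i \<odot>\<^bsub>M\<^esub> x i) = (\<Oplus>\<^bsub>N\<^esub>i\<in>A. c i \<odot>\<^bsub>N\<^esub> f (x i))"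
  using assms
proof (induction A rule: finite_induct)
  case (insert a A)
  then show ?case by (simp add: Pi_def)
qed simp

lemma (in module) span_image_nonzero_coeffsE:
  assumes "f ` I \<subseteq> carrier M" and "v \<in> span (f ` I)"
  obtains L c where "finite L" and "L \<subseteq> I" and "c \<in> L \<rightarrow> carrier R - {\<zero>}"
    and "v = (\<Oplus>\<^bsub>M\<^esub>l\<in>L. c l \<odot>\<^bsub>M\<^esub> f l)"
proof -
  obtain a A where A: "finite A" "A \<subseteq> f ` I" and coeffs: "a \<in> A \<rightarrow> carrier R"
    and v_eq: "v = lincomb a A"
    using assms(2) unfolding span_def by blast
  define S where "S = {w \<in> A. a w \<noteq> \<zero>}"
  have A_carrier: "A \<subseteq> carrier M"
    using A(2) assms(1) by (rule subset_trans)
  then have summands: "(\<lambda>w. a w \<odot>\<^bsub>M\<^esub> w) \<in> A \<rightarrow> carrier M"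
    using coeffs by auto
  have "S \<subseteq> f ` I"
    using A(2) by (auto simp: S_def)
  then obtain L where L: "L \<subseteq> I" "inj_on f L" "S = f ` L"
    unfolding subset_image_inj by blast
  have "finite L"
    using A(1) L(2) finite_imageD[of f L] unfolding L(3)[symmetric] S_def by simp
  moreover have "(\<lambda>l. a (f l)) \<in> L \<rightarrow> carrier R - {\<zero>}"
    using L(3) coeffs unfolding S_def by blast
  moreover have "v = (\<Oplus>\<^bsub>M\<^esub>l\<in>L. a (f l) \<odot>\<^bsub>M\<^esub> f l)"
  proof -
    have "v = (\<Oplus>\<^bsub>M\<^esub>w\<in>S. a w \<odot>\<^bsub>M\<^esub> w)"
      unfolding v_eq lincomb_def S_def using A(1) A_carrier summands
      by (intro M.add.finprod_mono_neutral_cong_right) auto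
    also have "\<dots> = (\<Oplus>\<^bsub>M\<^esub>l\<in>L. a (f l) \<odot>\<^bsub>M\<^esub> f l)"
      unfolding L(3) using summands L(2,3) by (intro M.finsum_reindex) (auto simp: S_def)
    finally show ?thesis .
  qed
  ultimately show ?thesis
    using that L(1) by blast
qed

lemma (in module) span_image_nonzero_lincombE:
  assumes "f ` I \<subseteq> carrier M" and "v \<in> span (f ` I)" and "v \<noteq> \<zero>\<^bsub>M\<^esub>"
  obtains k :: nat and g c where "1 \<le> k" and "inj_on g {1..k}" and "g ` {1..k} \<subseteq> I"
    and "\<And>i. i \<in> {1..k} \<Longrightarrow> c i \<in> carrier R - {\<zero>}"
    and "v = (\<Oplus>\<^bsub>M\<^esub>i\<in>{1..k}. c i \<odot>\<^bsub>M\<^esub> f (g i))"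
proof -
  obtain L c where L: "finite L" "L \<subseteq> I" and coeffs: "c \<in> L \<rightarrow> carrier R - {\<zero>}"
    and v_eq: "v = (\<Oplus>\<^bsub>M\<^esub>l\<in>L. c l \<odot>\<^bsub>M\<^esub> f l)"
    using span_image_nonzero_coeffsE[OF assms(1,2)] by blast
  obtain g k where bij: "bij_betw g {1..k} L" and "k = card L"
    using ex_bij_betw_nat_finite_1[OF L(1)] by blast
  have "L \<noteq> {}"
    using assms(3) v_eq by auto
  then have "1 \<le> k"
    using L(1) \<open>k = card L\<close> by (simp add: Suc_le_eq card_gt_0_iff)
  moreover have "inj_on g {1..k}" and image: "g ` {1..k} = L"
    using bij by (simp_all add: bij_betw_def)
  moreover have "c (g i) \<in> carrier R - {\<zero>}" if "i \<in> {1..k}" for i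
    using that image coeffs by blast
  moreover have "v = (\<Oplus>\<^bsub>M\<^esub>i\<in>{1..k}. c (g i) \<odot>\<^bsub>M\<^esub> f (g i))"
  proof -
    have "(\<lambda>l. c l \<odot>\<^bsub>M\<^esub> f l) \<in> L \<rightarrow> carrier M"
      using coeffs L(2) assms(1) by (intro Pi_I smult_closed) blast+
    with \<open>inj_on g {1..k}\<close> show ?thesis
      using M.finsum_reindex[of "\<lambda>l. c l \<odot>\<^bsub>M\<^esub> f l" g "{1..k}"] unfolding v_eq image by simp
  qed
  ultimately show ?thesis
    using that[of k g "\<lambda>i. c (g i)"] L(2) by simp
qed

lemma lincomb_array_rows:
  fixes X :: "('k::field, 'a) module"
  assumes X: "vectorspace scalar_field X" and "finite A"
    and entries: "\<And>i j. i \<in> A \<Longrightarrow> j \<in> {1..m} \<Longrightarrow> u (g i, j) \<in> carrier X"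
  shows "(\<Oplus>\<^bsub>power_space m X\<^esub>i\<in>A. c i \<odot>\<^bsub>power_space m X\<^esub> array_row {1..m} u (g i))
           = (\<lambda>j\<in>{1..m}. \<Oplus>\<^bsub>X\<^esub>i\<in>A. c i \<odot>\<^bsub>X\<^esub> u (g i, j))"
proof -
  interpret X: vectorspace scalar_field X by (fact X)
  have smult: "c i \<odot>\<^bsub>power_space m X\<^esub> array_row {1..m} u (g i)
      = (\<lambda>j\<in>{1..m}. c i \<odot>\<^bsub>X\<^esub> u (g i, j))" for i
    by (auto simp: power_space_def array_row_def)
  have "(\<Oplus>\<^bsub>power_space m X\<^esub>i\<in>A. (\<lambda>j\<in>{1..m}. c i \<odot>\<^bsub>X\<^esub> u (g i, j)))
      = (\<lambda>j\<in>{1..m}. \<Oplus>\<^bsub>X\<^esub>i\<in>A. (\<lambda>j\<in>{1..m}. c i \<odot>\<^bsub>X\<^esub> u (g i, j)) j)"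
    using entries by (intro finsum_power_space X \<open>finite A\<close>) auto
  also have "\<dots> = (\<lambda>j\<in>{1..m}. \<Oplus>\<^bsub>X\<^esub>i\<in>A. c i \<odot>\<^bsub>X\<^esub> u (g i, j))"
    by (intro restrict_ext) simp
  finally show ?thesis
    unfolding smult .
qed

section \<open>Recurrence of linear combinations\<close>

lemma D_phenomenon_lincomb:
  fixes k :: nat
  assumes phenomenon: "D_phenomenon X Y \<tau>Y \<Psi>" and "1 \<le> k"
    and "\<And>i. i \<in> {1..k} \<Longrightarrow> c i \<noteq> 0 \<and> x i \<in> carrier X"
    and "V \<in> \<Psi> (\<Oplus>\<^bsub>X\<^esub>i\<in>{1..k}. c i \<odot>\<^bsub>X\<^esub> x i)"
  shows "\<exists>W\<in>\<Pi> i\<in>{1..k}. \<Psi> (x i). \<forall>w\<in>Pi {1..k} W. (\<Oplus>\<^bsub>Y\<^esub>i\<in>{1..k}. c i \<odot>\<^bsub>Y\<^esub> w i) \<in> V"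
proof -
  obtain W where W: "\<forall>i\<in>{1..k}. W i \<in> \<Psi> (x i) \<and> W i \<noteq> {} \<and> openin \<tau>Y (W i)"
      "{(\<Oplus>\<^bsub>Y\<^esub>i\<in>{1..k}. c i \<odot>\<^bsub>Y\<^esub> w i) |w. \<forall>i\<in>{1..k}. w i \<in> W i} \<subseteq> V"
    using phenomenon[unfolded D_phenomenon_def, THEN conjunct2, rule_format, of k c x V] assms(2-4)
    by blast
  then show ?thesis
    by (intro bexI[of _ W]) blast+
qed

context
  fixes X :: "('k::real_normed_field, 'a) module" and Y :: "('k, 'b) module" and \<tau>Y :: "'b topology"
    and T :: "nat \<Rightarrow> 'a \<Rightarrow> 'b" and \<Psi> :: "'a \<Rightarrow> 'b set set" and \<F> :: "nat set set"
  assumes linear: "\<And>n. 1 \<le> n \<Longrightarrow> linear_map scalar_field X Y (T n)"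
    and phenomenon: "D_phenomenon X Y \<tau>Y \<Psi>" and Furstenberg: "Furstenberg_family \<F>"
begin

lemma jointly_recurrent_lincomb:
  fixes k :: nat
  assumes "1 \<le> k" and nonzero: "\<And>i. i \<in> {1..k} \<Longrightarrow> c i \<noteq> 0"
    and entries: "x \<in> {1..k} \<times> J \<rightarrow> carrier X"
    and recurrent: "jointly_recurrent \<F> \<Psi> T ({1..k} \<times> J) x"
  shows "jointly_recurrent \<F> \<Psi> T J (\<lambda>j. \<Oplus>\<^bsub>X\<^esub>i\<in>{1..k}. c i \<odot>\<^bsub>X\<^esub> x (i, j))"
  unfolding jointly_recurrent_def
proof
  let ?p = "\<lambda>j. \<Oplus>\<^bsub>X\<^esub>i\<in>{1..k}. c i \<odot>\<^bsub>X\<^esub> x (i, j)"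
  fix A assume "A \<in> (\<Pi> j\<in>J. \<Psi> (?p j))"
  then have "\<forall>j\<in>J. \<exists>W. W \<in> (\<Pi> i\<in>{1..k}. \<Psi> (x (i, j))) \<and>
      (\<forall>w\<in>Pi {1..k} W. (\<Oplus>\<^bsub>Y\<^esub>i\<in>{1..k}. c i \<odot>\<^bsub>Y\<^esub> w i) \<in> A j)"
    unfolding Bex_def[symmetric] using nonzero entries
    by (intro ballI D_phenomenon_lincomb[OF phenomenon \<open>1 \<le> k\<close>]) auto
  from bchoice[OF this] obtain W where
      W: "\<And>j. j \<in> J \<Longrightarrow> W j \<in> (\<Pi> i\<in>{1..k}. \<Psi> (x (i, j)))"
      "\<And>j w. j \<in> J \<Longrightarrow> w \<in> Pi {1..k} (W j) \<Longrightarrow> (\<Oplus>\<^bsub>Y\<^esub>i\<in>{1..k}. c i \<odot>\<^bsub>Y\<^esub> w i) \<in> A j"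
    by blast
  let ?visits = "{n. 1 \<le> n \<and> (\<forall>q\<in>{1..k} \<times> J. T n (x q) \<in> (\<lambda>(i, j). W j i) q)}"
  have "(\<lambda>(i, j). W j i) \<in> (\<Pi> q\<in>{1..k} \<times> J. \<Psi> (x q))"
    using W(1) by auto
  then have "?visits \<in> \<F>"
    by (rule jointly_recurrentD[OF recurrent])
  moreover have "?visits \<subseteq> {n. 1 \<le> n \<and> (\<forall>j\<in>J. T n (?p j) \<in> A j)}"
  proof (intro subsetI CollectI conjI ballI)
    fix n j assume n: "n \<in> ?visits" and j: "j \<in> J"
    interpret T: linear_map scalar_field X Y "T n"
      using n by (intro linear) simp
    have "T n (?p j) = (\<Oplus>\<^bsub>Y\<^esub>i\<in>{1..k}. c i \<odot>\<^bsub>Y\<^esub> T n (x (i, j)))"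
      using entries j by (intro T.hom_finsum_smult) auto
    also have "\<dots> \<in> A j"
      using n j by (intro W(2)) auto
    finally show "T n (?p j) \<in> A j" .
  qed simp
  ultimately show "{n. 1 \<le> n \<and> (\<forall>j\<in>J. T n (?p j) \<in> A j)} \<in> \<F>"
    using Furstenberg unfolding Furstenberg_family_def by blast
qed

lemma lincomb_array_rows_in_F_Psi:
  fixes k :: nat
  assumes "1 \<le> k" and "inj_on g {1..k}" and nonzero: "\<And>i. i \<in> {1..k} \<Longrightarrow> c i \<noteq> 0"
    and entries: "u \<in> g ` {1..k} \<times> {1..m} \<rightarrow> carrier X"
    and recurrent: "jointly_recurrent \<F> \<Psi> T (g ` {1..k} \<times> {1..m}) u"
  shows "(\<Oplus>\<^bsub>power_space m X\<^esub>i\<in>{1..k}. c i \<odot>\<^bsub>power_space m X\<^esub> array_row {1..m} u (g i))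
           \<in> F_Psi X \<F> \<Psi> T m"
proof -
  interpret T: linear_map scalar_field X Y "T 1"
    by (rule linear) simp
  define w where "w = u \<circ> map_prod g id"
  define p where "p j = (\<Oplus>\<^bsub>X\<^esub>i\<in>{1..k}. c i \<odot>\<^bsub>X\<^esub> w (i, j))" for j
  have w_entries: "w \<in> {1..k} \<times> {1..m} \<rightarrow> carrier X"
    using entries by (auto simp: w_def)
  have "bij_betw (map_prod g id) ({1..k} \<times> {1..m}) (g ` {1..k} \<times> {1..m})"
    using assms(2) by (auto simp: bij_betw_def map_prod_inj_on map_prod_surj_on)
  then have "jointly_recurrent \<F> \<Psi> T ({1..k} \<times> {1..m}) w"
    using recurrent by (subst jointly_recurrent_reindex[where y = u]) (auto simp: w_def)
  then have "jointly_recurrent \<F> \<Psi> T {1..m} p"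
    unfolding p_def using \<open>1 \<le> k\<close> nonzero w_entries by (intro jointly_recurrent_lincomb)
  then have "jointly_recurrent \<F> \<Psi> T {1..m} (\<lambda>j\<in>{1..m}. p j)"
    by (rule jointly_recurrent_bij_betw[OF bij_betw_id, rotated]) simp
  moreover have "(\<lambda>j\<in>{1..m}. p j) \<in> {1..m} \<rightarrow>\<^sub>E carrier X"
    unfolding p_def using Pi_mem[OF w_entries] by (auto intro!: T.V.module.M.finsum_closed)
  ultimately have "(\<lambda>j\<in>{1..m}. p j) \<in> F_Psi X \<F> \<Psi> T m"
    by (simp add: F_Psi_iff_jointly_recurrent)
  then show ?thesis
    using entries unfolding p_def w_def
    by (subst lincomb_array_rows[OF T.V.vectorspace_axioms]) auto
qed

lemma span_array_rows_subset_F_Psi: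
  assumes "1 \<le> m" and entries: "u \<in> I \<times> {1..m} \<rightarrow> carrier X"
    and recurrent: "\<And>F. finite F \<Longrightarrow> F \<noteq> {} \<Longrightarrow> F \<subseteq> I \<times> {1..m} \<Longrightarrow> jointly_recurrent \<F> \<Psi> T F u"
  shows "module.span scalar_field (power_space m X) (array_row {1..m} u ` I)
           \<subseteq> F_Psi X \<F> \<Psi> T m \<union> {\<zero>\<^bsub>power_space m X\<^esub>}"
proof
  interpret T: linear_map scalar_field X Y "T 1"
    by (rule linear) simp
  interpret P: vectorspace scalar_field "power_space m X"
    by (rule vectorspace_power_space[OF T.V.vectorspace_axioms])
  let ?row = "array_row {1..m} u"
  have rows: "?row ` I \<subseteq> carrier (power_space m X)"
    using entries by (auto simp: array_row_def power_space_def)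
  fix v assume v: "v \<in> P.span (?row ` I)"
  show "v \<in> F_Psi X \<F> \<Psi> T m \<union> {\<zero>\<^bsub>power_space m X\<^esub>}"
  proof (cases "v = \<zero>\<^bsub>power_space m X\<^esub>")
    case False
    obtain k :: nat and g c where "1 \<le> k" and "inj_on g {1..k}" and image: "g ` {1..k} \<subseteq> I"
      and nonzero: "\<And>i. i \<in> {1..k} \<Longrightarrow> c i \<in> carrier scalar_field - {\<zero>\<^bsub>scalar_field\<^esub>}"
      and v_eq: "v = (\<Oplus>\<^bsub>power_space m X\<^esub>i\<in>{1..k}. c i \<odot>\<^bsub>power_space m X\<^esub> ?row (g i))"
      by (rule P.span_image_nonzero_lincombE[OF rows v False]) blast
    have "jointly_recurrent \<F> \<Psi> T (g ` {1..k} \<times> {1..m}) u"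
      using \<open>1 \<le> k\<close> \<open>1 \<le> m\<close> image by (intro recurrent) auto
    moreover have "u \<in> g ` {1..k} \<times> {1..m} \<rightarrow> carrier X"
      using entries image by blast
    ultimately have "v \<in> F_Psi X \<F> \<Psi> T m"
      unfolding v_eq using \<open>1 \<le> k\<close> \<open>inj_on g {1..k}\<close> nonzero
      by (intro lincomb_array_rows_in_F_Psi) auto
    then show ?thesis ..
  qed simp
qed

end

lemma dense_lineable_span_array_rows:
  fixes X :: "('k::real_normed_field, 'a) module"
  assumes X: "vectorspace scalar_field X" and entries: "u \<in> I \<times> {1..m} \<rightarrow> carrier X"
    and dense: "power_topology m \<tau> closure_of (array_row {1..m} u ` I)
           = topspace (power_topology m \<tau>)"
    and span_subset: "module.span scalar_field (power_space m X) (array_row {1..m} u ` I)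
           \<subseteq> A \<union> {\<zero>\<^bsub>power_space m X\<^esub>}"
  shows "dense_lineable (power_space m X) (power_topology m \<tau>) A"
proof -
  interpret P: vectorspace scalar_field "power_space m X"
    by (rule vectorspace_power_space[OF X])
  have rows: "array_row {1..m} u ` I \<subseteq> carrier (power_space m X)"
    using entries by (auto simp: array_row_def power_space_def)
  then have "power_topology m \<tau> closure_of P.span (array_row {1..m} u ` I)
      = topspace (power_topology m \<tau>)"
    using closure_of_mono[OF P.in_own_span[OF rows]] dense closure_of_subset_topspace
    by (metis subset_antisym)
  then show ?thesis
    unfolding dense_lineable_def using P.span_is_subspace[OF rows] span_subset by blast
qed

theorem theorem4p3:
  fixes X :: "('k::real_normed_field, 'a) module" and \<tau>X :: "'a topology"
    and Y :: "nat \<Rightarrow> ('k, 'b) module" and \<tau>Y :: "nat \<Rightarrow> 'b topology"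
    and T :: "nat \<Rightarrow> nat \<Rightarrow> 'a \<Rightarrow> 'b"
    and \<Psi> :: "nat \<Rightarrow> 'a \<Rightarrow> 'b set set"
    and \<F> :: "nat \<Rightarrow> nat set set"
  assumes "F_space X \<tau>X" and "separable_space \<tau>X" and "infinite_dimensional X"
    and "\<And>i. 1 \<le> i \<Longrightarrow> topological_vector_space (Y i) (\<tau>Y i)"
    and "\<And>i n. 1 \<le> i \<Longrightarrow> 1 \<le> n \<Longrightarrow> linear_map scalar_field X (Y i) (T i n)"
    and "\<And>i. 1 \<le> i \<Longrightarrow> D_phenomenon X (Y i) (\<tau>Y i) (\<Psi> i)"
    and "\<And>i. 1 \<le> i \<Longrightarrow> proper_Furstenberg_family (\<F> i)"
    and "\<And>m i. 1 \<le> m \<Longrightarrow> 1 \<le> i \<Longrightarrow>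
           \<exists>R. residual_in (power_topology m \<tau>X) R \<and> R \<subseteq> F_Psi X (\<F> i) (\<Psi> i) (T i) m"
  shows "\<forall>m\<ge>1. dense_lineable (power_space m X) (power_topology m \<tau>X)
           (\<Inter>i\<in>{1..}. F_Psi X (\<F> i) (\<Psi> i) (T i) m)"
proof (intro allI impI)
  fix m :: nat assume "1 \<le> m"
  have X: "vectorspace scalar_field X" and space: "topspace \<tau>X = carrier X"
    and complete: "completely_metrizable_space \<tau>X"
    using assms(1) unfolding F_space_def topological_vector_space_def by auto
  then interpret X: vectorspace scalar_field X by blast
  have nonempty: "topspace \<tau>X \<noteq> {}"
    using X.zero_closed space by auto
  have residual: "residual_in (power_topology N \<tau>X) (F_Psi X (\<F> i) (\<Psi> i) (T i) N)"
    if "i \<in> {1..}" "1 \<le> N" for i N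
    using that assms(8)[of N i]
    by (auto simp: power_topology_def space F_Psi_iff_jointly_recurrent intro: residual_in_mono)
  obtain u :: "nat \<times> nat \<Rightarrow> 'a" where entries: "u \<in> UNIV \<times> {1..m} \<rightarrow>\<^sub>E carrier X"
    and dense: "power_topology m \<tau>X closure_of range (array_row {1..m} u)
                  = topspace (power_topology m \<tau>X)"
    and recurrent: "\<And>i F. i \<in> {1..} \<Longrightarrow> finite F \<Longrightarrow> F \<noteq> {} \<Longrightarrow> F \<subseteq> UNIV \<times> {1..m} \<Longrightarrow>
                      jointly_recurrent (\<F> i) (\<Psi> i) (T i) F u"
    unfolding space[symmetric] power_topology_def
    by (rule generic_array[OF complete assms(2) nonempty countableI_type infinite_UNIV_nat
          finite_atLeastAtMost countableI_type residual]) blast+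
  have "module.span scalar_field (power_space m X) (range (array_row {1..m} u))
      \<subseteq> F_Psi X (\<F> i) (\<Psi> i) (T i) m \<union> {\<zero>\<^bsub>power_space m X\<^esub>}" if "i \<in> {1..}" for i
    using that assms(5-7) \<open>1 \<le> m\<close> entries recurrent
    by (intro span_array_rows_subset_F_Psi[of X "Y i" "T i" "\<tau>Y i"])
      (auto simp: proper_Furstenberg_family_def)
  then show "dense_lineable (power_space m X) (power_topology m \<tau>X)
      (\<Inter>i\<in>{1..}. F_Psi X (\<F> i) (\<Psi> i) (T i) m)"
    using entries by (intro dense_lineable_span_array_rows[OF X _ dense]) auto
qed

end
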